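(* Let $n\ge1$ and let $\alpha_L(n)$, $\alpha_R(n)$ and $\alpha(n)$ denote the number of atoms in the free left-handed, the free right-handed and the free skew Boolean algebra on $n$ generators, respectively. Then $$\alpha_L(n)=\alpha_R(n)=n2^{n-1}\quad\text{and}\quad \alpha(n)=n(n+1)2^{n-2},\quad\text{so that}\quad \alpha(n)=\frac{n+1}{2}\,\alpha_L(n).$$
   Context: A skew lattice is an algebra $(S;\wedge,\vee)$ with associative binary operations satisfying $x\wedge(x\vee y)=x=(y\vee x)\wedge x$ and $x\vee(x\wedge y)=x=(y\wedge x)\vee x$. A skew Boolean algebra is an algebra $(S;\wedge,\vee,\setminus,0)$ such that $(S;\wedge,\vee)$ is a skew lattice satisfying $x\wedge(y\vee z)=(x\wedge y)\vee(x\wedge z)$ and $(x\vee y)\wedge z=(x\wedge z)\vee(y\wedge z)$, $0$ satisfies $0\wedge x=0=x\wedge 0$ and $0\vee x=x=x\vee 0$, and $(x\wedge y\wedge x)\vee(x\setminus y)=x$, $(x\wedge y\wedge x)\wedge(x\setminus y)=0=(x\setminus y)\wedge(x\wedge y\wedge x)$. It is left-handed if $x\wedge y\wedge x=x\wedge y$ and $x\vee y\vee x=y\vee x$ hold, right-handed if $x\wedge y\wedge x=y\wedge x$ and $x\vee y\vee x=x\vee y$ hold. Each of these classes is a variety, and free algebras are taken in the respective variety. The natural partial order is $x\ge y$ iff $x\wedge y=y=y\wedge x$; an atom is a minimal nonzero element in this order. *)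

theory Defs
  imports Complex_Main
begin

record 'a skew_alg =
  carrier :: "'a set"
  meet :: "'a \<Rightarrow> 'a \<Rightarrow> 'a"  (infixl "\<sqinter>\<index>" 70)
  join :: "'a \<Rightarrow> 'a \<Rightarrow> 'a"  (infixl "\<squnion>\<index>" 65)
  diff :: "'a \<Rightarrow> 'a \<Rightarrow> 'a"  (infixl "\<setminus>\<index>" 65)
  zero :: "'a"  ("\<zero>\<index>")

locale skew_lattice =
  fixes A :: "'a skew_alg" (structure)
  assumes meet_closed: "\<lbrakk>x \<in> carrier A; y \<in> carrier A\<rbrakk> \<Longrightarrow> x \<sqinter> y \<in> carrier A"
    and join_closed: "\<lbrakk>x \<in> carrier A; y \<in> carrier A\<rbrakk> \<Longrightarrow> x \<squnion> y \<in> carrier A"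
    and meet_assoc: "\<lbrakk>x \<in> carrier A; y \<in> carrier A; z \<in> carrier A\<rbrakk>
      \<Longrightarrow> (x \<sqinter> y) \<sqinter> z = x \<sqinter> (y \<sqinter> z)"
    and join_assoc: "\<lbrakk>x \<in> carrier A; y \<in> carrier A; z \<in> carrier A\<rbrakk>
      \<Longrightarrow> (x \<squnion> y) \<squnion> z = x \<squnion> (y \<squnion> z)"
    and meet_absorb1: "\<lbrakk>x \<in> carrier A; y \<in> carrier A\<rbrakk> \<Longrightarrow> x \<sqinter> (x \<squnion> y) = x"
    and meet_absorb2: "\<lbrakk>x \<in> carrier A; y \<in> carrier A\<rbrakk> \<Longrightarrow> (y \<squnion> x) \<sqinter> x = x"
    and join_absorb1: "\<lbrakk>x \<in> carrier A; y \<in> carrier A\<rbrakk> \<Longrightarrow> x \<squnion> (x \<sqinter> y) = x"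
    and join_absorb2: "\<lbrakk>x \<in> carrier A; y \<in> carrier A\<rbrakk> \<Longrightarrow> (y \<sqinter> x) \<squnion> x = x"

locale skew_boolean_algebra = skew_lattice +
  assumes diff_closed: "\<lbrakk>x \<in> carrier A; y \<in> carrier A\<rbrakk> \<Longrightarrow> x \<setminus> y \<in> carrier A"
    and zero_closed: "\<zero> \<in> carrier A"
    and meet_join_distrib: "\<lbrakk>x \<in> carrier A; y \<in> carrier A; z \<in> carrier A\<rbrakk>
      \<Longrightarrow> x \<sqinter> (y \<squnion> z) = (x \<sqinter> y) \<squnion> (x \<sqinter> z)"
    and join_meet_distrib: "\<lbrakk>x \<in> carrier A; y \<in> carrier A; z \<in> carrier A\<rbrakk>
      \<Longrightarrow> (x \<squnion> y) \<sqinter> z = (x \<sqinter> z) \<squnion> (y \<sqinter> z)"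
    and zero_meet: "x \<in> carrier A \<Longrightarrow> \<zero> \<sqinter> x = \<zero>"
    and meet_zero: "x \<in> carrier A \<Longrightarrow> x \<sqinter> \<zero> = \<zero>"
    and zero_join: "x \<in> carrier A \<Longrightarrow> \<zero> \<squnion> x = x"
    and join_zero: "x \<in> carrier A \<Longrightarrow> x \<squnion> \<zero> = x"
    and diff_join: "\<lbrakk>x \<in> carrier A; y \<in> carrier A\<rbrakk>
      \<Longrightarrow> (x \<sqinter> y \<sqinter> x) \<squnion> (x \<setminus> y) = x"
    and diff_meet1: "\<lbrakk>x \<in> carrier A; y \<in> carrier A\<rbrakk>
      \<Longrightarrow> (x \<sqinter> y \<sqinter> x) \<sqinter> (x \<setminus> y) = \<zero>"
    and diff_meet2: "\<lbrakk>x \<in> carrier A; y \<in> carrier A\<rbrakk>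
      \<Longrightarrow> (x \<setminus> y) \<sqinter> (x \<sqinter> y \<sqinter> x) = \<zero>"

locale left_handed_sba = skew_boolean_algebra +
  assumes left_meet: "\<lbrakk>x \<in> carrier A; y \<in> carrier A\<rbrakk> \<Longrightarrow> x \<sqinter> y \<sqinter> x = x \<sqinter> y"
    and left_join: "\<lbrakk>x \<in> carrier A; y \<in> carrier A\<rbrakk> \<Longrightarrow> x \<squnion> y \<squnion> x = y \<squnion> x"

locale right_handed_sba = skew_boolean_algebra +
  assumes right_meet: "\<lbrakk>x \<in> carrier A; y \<in> carrier A\<rbrakk> \<Longrightarrow> x \<sqinter> y \<sqinter> x = y \<sqinter> x"
    and right_join: "\<lbrakk>x \<in> carrier A; y \<in> carrier A\<rbrakk> \<Longrightarrow> x \<squnion> y \<squnion> x = x \<squnion> y"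

definition nat_ge :: "'a skew_alg \<Rightarrow> 'a \<Rightarrow> 'a \<Rightarrow> bool" where
  "nat_ge A x y \<longleftrightarrow> x \<sqinter>\<^bsub>A\<^esub> y = y \<and> y = y \<sqinter>\<^bsub>A\<^esub> x"

definition atoms :: "'a skew_alg \<Rightarrow> 'a set" where
  "atoms A = {a \<in> carrier A. a \<noteq> \<zero>\<^bsub>A\<^esub> \<and>
     (\<forall>b \<in> carrier A. b \<noteq> \<zero>\<^bsub>A\<^esub> \<and> nat_ge A a b \<longrightarrow> b = a)}"

definition alg_hom :: "'a skew_alg \<Rightarrow> 'b skew_alg \<Rightarrow> ('a \<Rightarrow> 'b) set" where
  "alg_hom A B = {h. h ` carrier A \<subseteq> carrier B \<and> h \<zero>\<^bsub>A\<^esub> = \<zero>\<^bsub>B\<^esub> \<and>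
     (\<forall>x \<in> carrier A. \<forall>y \<in> carrier A.
        h (x \<sqinter>\<^bsub>A\<^esub> y) = h x \<sqinter>\<^bsub>B\<^esub> h y \<and>
        h (x \<squnion>\<^bsub>A\<^esub> y) = h x \<squnion>\<^bsub>B\<^esub> h y \<and>
        h (x \<setminus>\<^bsub>A\<^esub> y) = h x \<setminus>\<^bsub>B\<^esub> h y)}"

definition congruence :: "'a skew_alg \<Rightarrow> ('a \<times> 'a) set \<Rightarrow> bool" where
  "congruence A \<theta> \<longleftrightarrow> equiv (carrier A) \<theta> \<and>
     (\<forall>(x, x') \<in> \<theta>. \<forall>(y, y') \<in> \<theta>.
        (x \<sqinter>\<^bsub>A\<^esub> y, x' \<sqinter>\<^bsub>A\<^esub> y') \<in> \<theta> \<and>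
        (x \<squnion>\<^bsub>A\<^esub> y, x' \<squnion>\<^bsub>A\<^esub> y') \<in> \<theta> \<and>
        (x \<setminus>\<^bsub>A\<^esub> y, x' \<setminus>\<^bsub>A\<^esub> y') \<in> \<theta>)"

definition quot_alg :: "'a skew_alg \<Rightarrow> ('a \<times> 'a) set \<Rightarrow> 'a set skew_alg" where
  "quot_alg A \<theta> =
    \<lparr> carrier = carrier A // \<theta>,
      meet = (\<lambda>P Q. \<Union>x \<in> P. \<Union>y \<in> Q. \<theta> `` {x \<sqinter>\<^bsub>A\<^esub> y}),
      join = (\<lambda>P Q. \<Union>x \<in> P. \<Union>y \<in> Q. \<theta> `` {x \<squnion>\<^bsub>A\<^esub> y}),
      diff = (\<lambda>P Q. \<Union>x \<in> P. \<Union>y \<in> Q. \<theta> `` {x \<setminus>\<^bsub>A\<^esub> y}),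
      zero = \<theta> `` {\<zero>\<^bsub>A\<^esub>} \<rparr>"

datatype (vars: 'v) sba_term =
    Var 'v
  | Zero
  | Meet "'v sba_term" "'v sba_term"
  | Join "'v sba_term" "'v sba_term"
  | Diff "'v sba_term" "'v sba_term"

definition term_alg :: "'v set \<Rightarrow> 'v sba_term skew_alg" where
  "term_alg X =
    \<lparr> carrier = {t. vars t \<subseteq> X}, meet = Meet, join = Join, diff = Diff, zero = Zero \<rparr>"

text \<open>
  The free algebra over \<open>X\<close> in a variety \<open>V\<close>, by Birkhoff's construction: the term algebra modulo
  the intersection of all congruences whose quotient lies in \<open>V\<close>. That it has the universal
  property with respect to algebras over arbitrary types is proved below for each of the three
  varieties.
\<close>

definition free_cong :: "('v sba_term set skew_alg \<Rightarrow> bool) \<Rightarrow> 'v set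
    \<Rightarrow> ('v sba_term \<times> 'v sba_term) set" where
  "free_cong V X = \<Inter> {\<theta>. congruence (term_alg X) \<theta> \<and> V (quot_alg (term_alg X) \<theta>)}"

definition free_alg :: "('v sba_term set skew_alg \<Rightarrow> bool) \<Rightarrow> 'v set
    \<Rightarrow> 'v sba_term set skew_alg" where
  "free_alg V X = quot_alg (term_alg X) (free_cong V X)"

definition free_gen :: "('v sba_term set skew_alg \<Rightarrow> bool) \<Rightarrow> 'v set
    \<Rightarrow> 'v \<Rightarrow> 'v sba_term set" where
  "free_gen V X x = free_cong V X `` {Var x}"

lemma term_alg_simps [simp]:
  "carrier (term_alg X) = {t. vars t \<subseteq> X}"
  "meet (term_alg X) = Meet" "join (term_alg X) = Join"
  "diff (term_alg X) = Diff" "zero (term_alg X) = Zero"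
  by (simp_all add: term_alg_def)

lemma quot_alg_ops:
  assumes \<theta>: "congruence A \<theta>" and x: "x \<in> carrier A" and y: "y \<in> carrier A"
  shows "\<theta> `` {x} \<sqinter>\<^bsub>quot_alg A \<theta>\<^esub> \<theta> `` {y} = \<theta> `` {x \<sqinter>\<^bsub>A\<^esub> y}"
    and "\<theta> `` {x} \<squnion>\<^bsub>quot_alg A \<theta>\<^esub> \<theta> `` {y} = \<theta> `` {x \<squnion>\<^bsub>A\<^esub> y}"
    and "\<theta> `` {x} \<setminus>\<^bsub>quot_alg A \<theta>\<^esub> \<theta> `` {y} = \<theta> `` {x \<setminus>\<^bsub>A\<^esub> y}"
proof -
  have eq: "equiv (carrier A) \<theta>" using \<theta> by (simp add: congruence_def)
  have *: "(\<Union>a \<in> \<theta> `` {x}. \<Union>b \<in> \<theta> `` {y}. \<theta> `` {f a b}) = \<theta> `` {f x y}"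
    if f: "\<And>a a' b b'. \<lbrakk>(a, a') \<in> \<theta>; (b, b') \<in> \<theta>\<rbrakk> \<Longrightarrow> (f a b, f a' b') \<in> \<theta>" for f
  proof -
    have "\<theta> `` {f a b} = \<theta> `` {f x y}" if "a \<in> \<theta> `` {x}" "b \<in> \<theta> `` {y}" for a b
      using f[of x a y b] that equiv_class_eq[OF eq] by fastforce
    moreover have "x \<in> \<theta> `` {x}" "y \<in> \<theta> `` {y}"
      using equiv_class_self[OF eq] x y by simp_all
    ultimately show ?thesis by blast
  qed
  show "\<theta> `` {x} \<sqinter>\<^bsub>quot_alg A \<theta>\<^esub> \<theta> `` {y} = \<theta> `` {x \<sqinter>\<^bsub>A\<^esub> y}"
    and "\<theta> `` {x} \<squnion>\<^bsub>quot_alg A \<theta>\<^esub> \<theta> `` {y} = \<theta> `` {x \<squnion>\<^bsub>A\<^esub> y}"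
    and "\<theta> `` {x} \<setminus>\<^bsub>quot_alg A \<theta>\<^esub> \<theta> `` {y} = \<theta> `` {x \<setminus>\<^bsub>A\<^esub> y}"
    unfolding quot_alg_def using \<theta>
    by (simp_all, auto intro!: * simp: congruence_def)
qed

lemma quot_alg_carrier: "carrier (quot_alg A \<theta>) = (\<lambda>x. \<theta> `` {x}) ` carrier A"
  by (auto simp: quot_alg_def quotient_def)

lemma quot_alg_zero: "\<zero>\<^bsub>quot_alg A \<theta>\<^esub> = \<theta> `` {\<zero>\<^bsub>A\<^esub>}"
  by (simp add: quot_alg_def)

lemma all_image:
  "(\<forall>x. x \<in> f ` T \<longrightarrow> P x) \<longleftrightarrow> (\<forall>x \<in> T. P (f x))"
  "(\<forall>x y. x \<in> f ` T \<longrightarrow> y \<in> f ` T \<longrightarrow> Q x y) \<longleftrightarrow> (\<forall>x \<in> T. \<forall>y \<in> T. Q (f x) (f y))"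
  "(\<forall>x y z. x \<in> f ` T \<longrightarrow> y \<in> f ` T \<longrightarrow> z \<in> f ` T \<longrightarrow> R x y z) \<longleftrightarrow>
    (\<forall>x \<in> T. \<forall>y \<in> T. \<forall>z \<in> T. R (f x) (f y) (f z))"
  by blast+

lemmas variety_defs = skew_lattice_def skew_boolean_algebra_def skew_boolean_algebra_axioms_def
  left_handed_sba_def left_handed_sba_axioms_def right_handed_sba_def right_handed_sba_axioms_def

lemma quot_term_simps:
  fixes X \<theta> defines "Q \<equiv> quot_alg (term_alg X) \<theta>"
  assumes \<theta>: "congruence (term_alg X) \<theta>"
  shows "carrier Q = (\<lambda>x. \<theta> `` {x}) ` {t. vars t \<subseteq> X}"
    and "\<zero>\<^bsub>Q\<^esub> = \<theta> `` {Zero}"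
    and "\<lbrakk>vars s \<subseteq> X; vars t \<subseteq> X\<rbrakk> \<Longrightarrow> \<theta> `` {s} \<sqinter>\<^bsub>Q\<^esub> \<theta> `` {t} = \<theta> `` {Meet s t}"
    and "\<lbrakk>vars s \<subseteq> X; vars t \<subseteq> X\<rbrakk> \<Longrightarrow> \<theta> `` {s} \<squnion>\<^bsub>Q\<^esub> \<theta> `` {t} = \<theta> `` {Join s t}"
    and "\<lbrakk>vars s \<subseteq> X; vars t \<subseteq> X\<rbrakk> \<Longrightarrow> \<theta> `` {s} \<setminus>\<^bsub>Q\<^esub> \<theta> `` {t} = \<theta> `` {Diff s t}"
    and "\<lbrakk>vars s \<subseteq> X; vars t \<subseteq> X\<rbrakk> \<Longrightarrow> \<theta> `` {s} = \<theta> `` {t} \<longleftrightarrow> (s, t) \<in> \<theta>"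
proof -
  have eq: "equiv {t. vars t \<subseteq> X} \<theta>"
    using \<theta> by (simp add: congruence_def)
  show "carrier Q = (\<lambda>x. \<theta> `` {x}) ` {t. vars t \<subseteq> X}" and "\<zero>\<^bsub>Q\<^esub> = \<theta> `` {Zero}"
    by (simp_all add: Q_def quot_alg_carrier quot_alg_zero)
  assume "vars s \<subseteq> X" "vars t \<subseteq> X"
  then show "\<theta> `` {s} \<sqinter>\<^bsub>Q\<^esub> \<theta> `` {t} = \<theta> `` {Meet s t}"
    and "\<theta> `` {s} \<squnion>\<^bsub>Q\<^esub> \<theta> `` {t} = \<theta> `` {Join s t}"
    and "\<theta> `` {s} \<setminus>\<^bsub>Q\<^esub> \<theta> `` {t} = \<theta> `` {Diff s t}"
    and "\<theta> `` {s} = \<theta> `` {t} \<longleftrightarrow> (s, t) \<in> \<theta>"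
    using quot_alg_ops[OF \<theta>] eq_equiv_class_iff[OF eq] by (simp_all add: Q_def)
qed

lemma congruence_Inter:
  assumes "F \<noteq> {}" and "\<And>\<theta>. \<theta> \<in> F \<Longrightarrow> congruence A \<theta>"
  shows "congruence A (\<Inter> F)"
proof -
  have eq: "equiv (carrier A) \<theta>" if "\<theta> \<in> F" for \<theta>
    using assms(2)[OF that] by (simp add: congruence_def)
  have "equiv (carrier A) (\<Inter> F)"
  proof (rule equivI)
    show "\<Inter> F \<subseteq> carrier A \<times> carrier A"
      using assms(1) eq equiv_type by blast
    show "refl_on (carrier A) (\<Inter> F)"
      using eq by (auto simp: equiv_def refl_on_def)
    show "sym (\<Inter> F)"
      using eq by (auto simp: equiv_def intro!: symI dest: symD)
    show "trans (\<Inter> F)"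
      using eq by (fastforce simp: equiv_def intro!: transI dest: transD)
  qed
  then show ?thesis
    using assms(2) unfolding congruence_def by fastforce
qed

fun sba_eval :: "'b skew_alg \<Rightarrow> ('v \<Rightarrow> 'b) \<Rightarrow> 'v sba_term \<Rightarrow> 'b" where
  "sba_eval B f (Var x) = f x"
| "sba_eval B f Zero = \<zero>\<^bsub>B\<^esub>"
| "sba_eval B f (Meet s t) = sba_eval B f s \<sqinter>\<^bsub>B\<^esub> sba_eval B f t"
| "sba_eval B f (Join s t) = sba_eval B f s \<squnion>\<^bsub>B\<^esub> sba_eval B f t"
| "sba_eval B f (Diff s t) = sba_eval B f s \<setminus>\<^bsub>B\<^esub> sba_eval B f t"

definition eval_ker :: "'v set \<Rightarrow> 'b skew_alg \<Rightarrow> ('v \<Rightarrow> 'b) \<Rightarrow> ('v sba_term \<times> 'v sba_term) set" where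
  "eval_ker X B f = {(s, t). vars s \<subseteq> X \<and> vars t \<subseteq> X \<and> sba_eval B f s = sba_eval B f t}"

lemma congruence_eval_ker: "congruence (term_alg X) (eval_ker X B f)"
  unfolding congruence_def equiv_def refl_on_def sym_def trans_def eval_ker_def by auto

lemma eval_closed:
  assumes B: "skew_boolean_algebra B" and f: "f ` X \<subseteq> carrier B"
  shows "vars t \<subseteq> X \<Longrightarrow> sba_eval B f t \<in> carrier B"
proof -
  interpret skew_boolean_algebra B by fact
  show "vars t \<subseteq> X \<Longrightarrow> sba_eval B f t \<in> carrier B"
    using f by (induction t) (auto intro: meet_closed join_closed diff_closed zero_closed)
qed

lemma quot_Inter:
  assumes "F \<noteq> {}" and "\<And>\<theta>. \<theta> \<in> F \<Longrightarrow> congruence (term_alg X) \<theta>"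
  shows "(\<And>\<theta>. \<theta> \<in> F \<Longrightarrow> skew_boolean_algebra (quot_alg (term_alg X) \<theta>)) \<Longrightarrow>
      skew_boolean_algebra (quot_alg (term_alg X) (\<Inter> F))"
    and "(\<And>\<theta>. \<theta> \<in> F \<Longrightarrow> left_handed_sba (quot_alg (term_alg X) \<theta>)) \<Longrightarrow>
      left_handed_sba (quot_alg (term_alg X) (\<Inter> F))"
    and "(\<And>\<theta>. \<theta> \<in> F \<Longrightarrow> right_handed_sba (quot_alg (term_alg X) \<theta>)) \<Longrightarrow>
      right_handed_sba (quot_alg (term_alg X) (\<Inter> F))"
proof -
  note simps = all_image quot_term_simps[OF congruence_Inter[OF assms]] quot_term_simps[OF assms(2)]
  have sba: "skew_boolean_algebra (quot_alg (term_alg X) (\<Inter> F))"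
    if "\<forall>\<theta> \<in> F. skew_boolean_algebra (quot_alg (term_alg X) \<theta>)"
    using that unfolding skew_lattice_def skew_boolean_algebra_def skew_boolean_algebra_axioms_def
    by (simp add: simps)
  then show "skew_boolean_algebra (quot_alg (term_alg X) (\<Inter> F))"
    if "\<And>\<theta>. \<theta> \<in> F \<Longrightarrow> skew_boolean_algebra (quot_alg (term_alg X) \<theta>)"
    using that by blast
  show "left_handed_sba (quot_alg (term_alg X) (\<Inter> F))"
    if "\<And>\<theta>. \<theta> \<in> F \<Longrightarrow> left_handed_sba (quot_alg (term_alg X) \<theta>)"
    using that sba unfolding left_handed_sba_def left_handed_sba_axioms_def by (simp add: simps)
  show "right_handed_sba (quot_alg (term_alg X) (\<Inter> F))"
    if "\<And>\<theta>. \<theta> \<in> F \<Longrightarrow> right_handed_sba (quot_alg (term_alg X) \<theta>)"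
    using that sba unfolding right_handed_sba_def right_handed_sba_axioms_def by (simp add: simps)
qed

lemma quot_eval_ker:
  assumes f: "f ` X \<subseteq> carrier B"
  shows "skew_boolean_algebra B \<Longrightarrow> skew_boolean_algebra (quot_alg (term_alg X) (eval_ker X B f))"
    and "left_handed_sba B \<Longrightarrow> left_handed_sba (quot_alg (term_alg X) (eval_ker X B f))"
    and "right_handed_sba B \<Longrightarrow> right_handed_sba (quot_alg (term_alg X) (eval_ker X B f))"
proof -
  note simps = quot_term_simps[OF congruence_eval_ker] all_image
  have mem: "(s, t) \<in> eval_ker X B f \<longleftrightarrow> sba_eval B f s = sba_eval B f t"
    if "vars s \<subseteq> X" "vars t \<subseteq> X" for s t
    using that by (simp add: eval_ker_def)
  show sba: "skew_boolean_algebra (quot_alg (term_alg X) (eval_ker X B f))"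
    if B: "skew_boolean_algebra B"
  proof -
    interpret skew_boolean_algebra B by fact
    note laws = meet_absorb1 meet_absorb2 join_absorb1 join_absorb2 meet_join_distrib
      join_meet_distrib zero_meet meet_zero zero_join join_zero diff_join diff_meet1 diff_meet2
    show ?thesis
      unfolding variety_defs
      by (simp add: simps mem laws eval_closed[OF B f])
        (simp add: meet_assoc join_assoc eval_closed[OF B f])
  qed
  show "left_handed_sba (quot_alg (term_alg X) (eval_ker X B f))" if B: "left_handed_sba B"
  proof -
    interpret left_handed_sba B by fact
    note sba[OF skew_boolean_algebra_axioms]
    moreover note eval_closed[OF skew_boolean_algebra_axioms f]
    ultimately show ?thesis
      unfolding left_handed_sba_def left_handed_sba_axioms_def
      by (simp add: simps mem left_meet left_join)
  qed
  show "right_handed_sba (quot_alg (term_alg X) (eval_ker X B f))" if B: "right_handed_sba B"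
  proof -
    interpret right_handed_sba B by fact
    note sba[OF skew_boolean_algebra_axioms]
    moreover note eval_closed[OF skew_boolean_algebra_axioms f]
    ultimately show ?thesis
      unfolding right_handed_sba_def right_handed_sba_axioms_def
      by (simp add: simps mem right_meet right_join)
  qed
qed

lemma variety_trivial:
  fixes A :: "unit skew_alg"
  assumes "carrier A = UNIV"
  shows "skew_boolean_algebra A" "left_handed_sba A" "right_handed_sba A"
  using assms unfolding variety_defs by simp_all

lemma free_alg_universal:
  fixes B :: "'b skew_alg" and V :: "'v sba_term set skew_alg \<Rightarrow> bool"
  assumes ker: "V (quot_alg (term_alg X) (eval_ker X B f))"
    and B: "skew_boolean_algebra B" and f: "f ` X \<subseteq> carrier B"
  shows "\<exists>h \<in> alg_hom (free_alg V X) B. (\<forall>x \<in> X. h (free_gen V X x) = f x) \<and>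
    (\<forall>h' \<in> alg_hom (free_alg V X) B. (\<forall>x \<in> X. h' (free_gen V X x) = f x) \<longrightarrow>
      (\<forall>a \<in> carrier (free_alg V X). h' a = h a))"
proof -
  define F where "F = {\<theta>. congruence (term_alg X) \<theta> \<and> V (quot_alg (term_alg X) \<theta>)}"
  have kerF: "eval_ker X B f \<in> F"
    using ker congruence_eval_ker by (auto simp: F_def)
  then have cong: "congruence (term_alg X) (free_cong V X)"
    unfolding free_cong_def F_def[symmetric]
    by (intro congruence_Inter) (auto simp: F_def)
  have sub: "free_cong V X \<subseteq> eval_ker X B f"
    using kerF by (auto simp: free_cong_def F_def)
  let ?\<theta> = "free_cong V X"
  note qs = quot_term_simps[OF cong, folded free_alg_def]
  define h where "h P = sba_eval B f (SOME t. t \<in> P)" for P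
  have h: "h (?\<theta> `` {t}) = sba_eval B f t" if "vars t \<subseteq> X" for t
  proof -
    have "t \<in> ?\<theta> `` {t}"
      using cong that equiv_class_self unfolding congruence_def by fastforce
    then have "(SOME u. u \<in> ?\<theta> `` {t}) \<in> ?\<theta> `` {t}"
      by (rule someI)
    then have "(t, SOME u. u \<in> ?\<theta> `` {t}) \<in> eval_ker X B f"
      using sub by auto
    then show ?thesis
      by (simp add: h_def eval_ker_def)
  qed
  have "h \<in> alg_hom (free_alg V X) B"
    using eval_closed[OF B f] by (auto simp: alg_hom_def qs h)
  moreover have "\<forall>x \<in> X. h (free_gen V X x) = f x"
    by (simp add: free_gen_def h)
  moreover have "h' a = h a"
    if h': "h' \<in> alg_hom (free_alg V X) B" "\<forall>x \<in> X. h' (free_gen V X x) = f x"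
      and a: "a \<in> carrier (free_alg V X)" for h' a
  proof -
    have "h' (?\<theta> `` {t}) = sba_eval B f t" if "vars t \<subseteq> X" for t
      using that
    proof (induction t)
      case (Var x)
      then show ?case using h'(2) by (simp add: free_gen_def)
    next
      case Zero
      then show ?case using h'(1) by (simp add: alg_hom_def qs)
    next
      case (Meet s t)
      then have "h' (?\<theta> `` {s} \<sqinter>\<^bsub>free_alg V X\<^esub> ?\<theta> `` {t}) =
          h' (?\<theta> `` {s}) \<sqinter>\<^bsub>B\<^esub> h' (?\<theta> `` {t})"
        using h'(1) by (simp add: alg_hom_def qs(1))
      with Meet show ?case by (simp add: qs)
    next
      case (Join s t)
      then have "h' (?\<theta> `` {s} \<squnion>\<^bsub>free_alg V X\<^esub> ?\<theta> `` {t}) =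
          h' (?\<theta> `` {s}) \<squnion>\<^bsub>B\<^esub> h' (?\<theta> `` {t})"
        using h'(1) by (simp add: alg_hom_def qs(1))
      with Join show ?case by (simp add: qs)
    next
      case (Diff s t)
      then have "h' (?\<theta> `` {s} \<setminus>\<^bsub>free_alg V X\<^esub> ?\<theta> `` {t}) =
          h' (?\<theta> `` {s}) \<setminus>\<^bsub>B\<^esub> h' (?\<theta> `` {t})"
        using h'(1) by (simp add: alg_hom_def qs(1))
      with Diff show ?case by (simp add: qs)
    qed
    with a show ?thesis by (auto simp: qs(1) h)
  qed
  ultimately show ?thesis by blast
qed

lemma free_alg_in_variety:
  "skew_boolean_algebra (free_alg skew_boolean_algebra X)"
  "left_handed_sba (free_alg left_handed_sba X)"
  "right_handed_sba (free_alg right_handed_sba X)"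
proof -
  define U :: "unit skew_alg" where "U = \<lparr>carrier = UNIV, meet = \<lambda>_ _. (), join = \<lambda>_ _. (),
    diff = \<lambda>_ _. (), zero = ()\<rparr>"
  have U: "skew_boolean_algebra U" "left_handed_sba U" "right_handed_sba U"
    by (simp_all add: variety_trivial U_def)
  have "(\<lambda>_. ()) ` X \<subseteq> carrier U" by (simp add: U_def)
  note ker = quot_eval_ker[OF this]
  note c = congruence_eval_ker[of X U "\<lambda>_. ()"]
  show "skew_boolean_algebra (free_alg skew_boolean_algebra X)"
    unfolding free_alg_def free_cong_def using c ker(1)[OF U(1)] by (intro quot_Inter(1)) auto
  show "left_handed_sba (free_alg left_handed_sba X)"
    unfolding free_alg_def free_cong_def using c ker(2)[OF U(2)] by (intro quot_Inter(2)) auto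
  show "right_handed_sba (free_alg right_handed_sba X)"
    unfolding free_alg_def free_cong_def using c ker(3)[OF U(3)] by (intro quot_Inter(3)) auto
qed

theorem free_skew_boolean_algebra_universal:
  assumes "skew_boolean_algebra B" and "f ` X \<subseteq> carrier B"
  shows "\<exists>h \<in> alg_hom (free_alg skew_boolean_algebra X) B.
    (\<forall>x \<in> X. h (free_gen skew_boolean_algebra X x) = f x) \<and>
    (\<forall>h' \<in> alg_hom (free_alg skew_boolean_algebra X) B.
      (\<forall>x \<in> X. h' (free_gen skew_boolean_algebra X x) = f x) \<longrightarrow>
      (\<forall>a \<in> carrier (free_alg skew_boolean_algebra X). h' a = h a))"
  using assms by (intro free_alg_universal quot_eval_ker)

theorem free_left_handed_sba_universal:
  assumes "left_handed_sba B" and "f ` X \<subseteq> carrier B"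
  shows "\<exists>h \<in> alg_hom (free_alg left_handed_sba X) B.
    (\<forall>x \<in> X. h (free_gen left_handed_sba X x) = f x) \<and>
    (\<forall>h' \<in> alg_hom (free_alg left_handed_sba X) B.
      (\<forall>x \<in> X. h' (free_gen left_handed_sba X x) = f x) \<longrightarrow>
      (\<forall>a \<in> carrier (free_alg left_handed_sba X). h' a = h a))"
  using assms by (intro free_alg_universal quot_eval_ker) (simp_all add: left_handed_sba_def)

theorem free_right_handed_sba_universal:
  assumes "right_handed_sba B" and "f ` X \<subseteq> carrier B"
  shows "\<exists>h \<in> alg_hom (free_alg right_handed_sba X) B.
    (\<forall>x \<in> X. h (free_gen right_handed_sba X x) = f x) \<and>
    (\<forall>h' \<in> alg_hom (free_alg right_handed_sba X) B.
      (\<forall>x \<in> X. h' (free_gen right_handed_sba X x) = f x) \<longrightarrow>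
      (\<forall>a \<in> carrier (free_alg right_handed_sba X). h' a = h a))"
  using assms by (intro free_alg_universal quot_eval_ker) (simp_all add: right_handed_sba_def)

definition alpha_L :: "nat \<Rightarrow> nat" where
  "alpha_L n = card (atoms (free_alg left_handed_sba {..<n}))"

definition alpha_R :: "nat \<Rightarrow> nat" where
  "alpha_R n = card (atoms (free_alg right_handed_sba {..<n}))"

definition alpha :: "nat \<Rightarrow> nat" where
  "alpha n = card (atoms (free_alg skew_boolean_algebra {..<n}))"

end

theory Submission
  imports Defs
begin

text \<open>
  The meet of a skew Boolean algebra is a normal band: the inner factors of a meet may be permuted.
  By this and distributivity, every map \<open>t \<mapsto> e \<sqinter> t \<sqinter> e\<close> respects meet and join. An element
  \<open>e \<noteq> \<zero>\<close> is an atom exactly if it decides every element \<open>t\<close>, that is, if \<open>e \<sqinter> t \<sqinter> e\<close> is \<open>e\<close> or \<open>\<zero>\<close>. The elements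
  decided by \<open>e\<close> are closed under all operations, so that it suffices to test the generators.

  Let now \<open>x k\<close>, for \<open>k\<close> in a finite set \<open>I\<close>, generate the algebra. An atom \<open>a\<close> has a support
  \<open>S \<subseteq> I\<close>, the set of generators with \<open>a \<sqinter> x k \<sqinter> a = a\<close>. The support fixes the value of the atom
  at every element, so two atoms with the same support lie in the same rectangular class. Within
  that class an atom is located by a row and a column: there are \<open>i, j \<in> S\<close> with \<open>x i \<sqinter> a = a\<close> and
  \<open>a \<sqinter> x j = a\<close>, and the label \<open>(S, i, j)\<close> determines \<open>a\<close>.

  In the free algebra every label occurs and no atom has two labels. This is seen in the
  primitive algebra \<open>(S \<times> S) \<union> {\<zero>}\<close>, to which there is a homomorphism that sends \<open>x k\<close> to \<open>(k, k)\<close>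
  if \<open>k \<in> S\<close> and to \<open>\<zero>\<close> otherwise: an element with the prescribed values at the generators is
  built by cutting down one of them, it stays nonzero because its image does, and the image of an
  atom shows \<open>i\<close> and \<open>j\<close>. In the one-sided varieties one of the two coordinates collapses. So the
  atoms are counted by \<open>\<Sum> |S|\<^sup>2\<close> in general and by \<open>\<Sum> |S|\<close> in the one-sided cases, where \<open>S\<close>
  runs over the subsets of \<open>I\<close>.
\<close>

section \<open>The meet operation is a normal band\<close>

context skew_boolean_algebra
begin

lemma meet_idem: "x \<in> carrier A \<Longrightarrow> x \<sqinter> x = x"
  by (metis join_absorb1 meet_absorb1 meet_closed)

lemma join_idem: "x \<in> carrier A \<Longrightarrow> x \<squnion> x = x"
  by (metis join_absorb1 meet_idem)

lemma meet_left_idem: "\<lbrakk>x \<in> carrier A; y \<in> carrier A\<rbrakk> \<Longrightarrow> x \<sqinter> (x \<sqinter> y) = x \<sqinter> y"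
  by (metis meet_assoc meet_idem)

lemmas closed = meet_closed join_closed diff_closed zero_closed
lemmas band_simps = meet_assoc meet_idem meet_left_idem closed

text \<open>
  This is where strong distributivity enters. If \<open>u, v \<le> x\<close>, then \<open>x\<close> absorbs \<open>u\<close> in joins, and
  expanding \<open>v = (x \<squnion> u) \<sqinter> v = v \<sqinter> (u \<squnion> x)\<close> shows that both \<open>u \<sqinter> v\<close> and \<open>v \<sqinter> u\<close> are absorbed
  by \<open>v\<close>, so that both are equal to \<open>v \<sqinter> u \<sqinter> v\<close>.
\<close>
lemma meet_commute_below:
  assumes C: "x \<in> carrier A" "u \<in> carrier A" "v \<in> carrier A"
    and u: "x \<sqinter> u = u" "u \<sqinter> x = u" and v: "x \<sqinter> v = v" "v \<sqinter> x = v"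
  shows "u \<sqinter> v = v \<sqinter> u"
proof -
  have "x \<squnion> u = x" "u \<squnion> x = x"
    using join_absorb1[of x u] join_absorb2[of x u] C u by simp_all
  then have "v \<squnion> u \<sqinter> v = v" "v \<sqinter> u \<squnion> v = v"
    using join_meet_distrib[of x u v] meet_join_distrib[of v u x] C v by simp_all
  then have "v \<sqinter> (u \<sqinter> v) = u \<sqinter> v" "(v \<sqinter> u) \<sqinter> v = v \<sqinter> u"
    using meet_absorb2[of "u \<sqinter> v" v] meet_absorb1[of "v \<sqinter> u" v] C by (simp_all add: closed)
  then show ?thesis using C by (simp add: meet_assoc)
qed

lemma meet_commute_local:
  assumes C: "z \<in> carrier A" "x \<in> carrier A" "y \<in> carrier A"
  shows "z \<sqinter> (x \<sqinter> (z \<sqinter> (y \<sqinter> z))) = z \<sqinter> (y \<sqinter> (z \<sqinter> (x \<sqinter> z)))"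
  using meet_commute_below[of z "z \<sqinter> (x \<sqinter> z)" "z \<sqinter> (y \<sqinter> z)"] C by (simp add: band_simps)

text \<open>
  A pure band argument: by local commutativity, \<open>u v w u\<close> absorbs \<open>u v u\<close> on the right and \<open>u w u\<close>
  on the left. The first fact makes \<open>z x y z\<close> absorb \<open>z x z y z\<close> on the right; by the second,
  \<open>z x z y z\<close> has \<open>z x y z\<close> as a left factor, so that the same product is \<open>z x z y z\<close>.
\<close>
lemma meet_insert_middle:
  assumes C: "z \<in> carrier A" "x \<in> carrier A" "y \<in> carrier A"
  shows "z \<sqinter> (x \<sqinter> (y \<sqinter> z)) = z \<sqinter> (x \<sqinter> (z \<sqinter> (y \<sqinter> z)))"
proof -
  have app1: "u \<sqinter> (v \<sqinter> (w \<sqinter> (u \<sqinter> (v \<sqinter> u)))) = u \<sqinter> (v \<sqinter> (w \<sqinter> u))"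
    and app2: "u \<sqinter> (w \<sqinter> (u \<sqinter> (v \<sqinter> (w \<sqinter> u)))) = u \<sqinter> (v \<sqinter> (w \<sqinter> u))"
    if "u \<in> carrier A" "v \<in> carrier A" "w \<in> carrier A" for u v w
  proof -
    have "u \<sqinter> (v \<sqinter> (u \<sqinter> (v \<sqinter> (w \<sqinter> u)))) = u \<sqinter> (v \<sqinter> (w \<sqinter> u))"
      using meet_left_idem[of "u \<sqinter> v" "w \<sqinter> u"] that by (simp add: meet_assoc closed)
    then show "u \<sqinter> (v \<sqinter> (w \<sqinter> (u \<sqinter> (v \<sqinter> u)))) = u \<sqinter> (v \<sqinter> (w \<sqinter> u))"
      using meet_commute_local[of u "v \<sqinter> w" v] that by (simp add: meet_assoc closed)
    have "u \<sqinter> (v \<sqinter> (w \<sqinter> (u \<sqinter> (w \<sqinter> u)))) = u \<sqinter> (v \<sqinter> (w \<sqinter> u))"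
      using meet_idem[of "w \<sqinter> u"] that by (simp add: meet_assoc closed)
    then show "u \<sqinter> (w \<sqinter> (u \<sqinter> (v \<sqinter> (w \<sqinter> u)))) = u \<sqinter> (v \<sqinter> (w \<sqinter> u))"
      using meet_commute_local[of u "v \<sqinter> w" w] that by (simp add: meet_assoc closed)
  qed
  let ?P = "z \<sqinter> (x \<sqinter> (y \<sqinter> z))" and ?Q = "z \<sqinter> (x \<sqinter> (z \<sqinter> (y \<sqinter> z)))"
  let ?R = "x \<sqinter> (z \<sqinter> (y \<sqinter> (z \<sqinter> (x \<sqinter> (z \<sqinter> (y \<sqinter> z))))))"
  have "?P \<sqinter> ?Q = (z \<sqinter> (x \<sqinter> (y \<sqinter> (z \<sqinter> (x \<sqinter> z))))) \<sqinter> (y \<sqinter> z)"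
    using C by (simp add: band_simps)
  also have "\<dots> = ?P \<sqinter> (y \<sqinter> z)"
    using C by (simp add: app1)
  also have "\<dots> = ?P"
    using meet_idem[of "y \<sqinter> z"] C by (simp add: meet_assoc closed)
  finally have PQ: "?P \<sqinter> ?Q = ?P" .
  have "?Q = z \<sqinter> ((x \<sqinter> (z \<sqinter> ((y \<sqinter> z) \<sqinter> x))) \<sqinter> (z \<sqinter> (y \<sqinter> z)))"
    using meet_idem[of ?Q] C by (simp add: meet_assoc meet_left_idem closed)
  also have "x \<sqinter> (z \<sqinter> ((y \<sqinter> z) \<sqinter> x)) = x \<sqinter> ((y \<sqinter> z) \<sqinter> (x \<sqinter> (z \<sqinter> ((y \<sqinter> z) \<sqinter> x))))"
    using app2[of x z "y \<sqinter> z"] C by (simp add: closed)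
  also have "z \<sqinter> (x \<sqinter> ((y \<sqinter> z) \<sqinter> (x \<sqinter> (z \<sqinter> ((y \<sqinter> z) \<sqinter> x)))) \<sqinter> (z \<sqinter> (y \<sqinter> z))) = ?P \<sqinter> ?R"
    using C by (simp add: band_simps)
  finally have Q: "?Q = ?P \<sqinter> ?R" .
  then have "?P \<sqinter> ?Q = ?Q"
    using meet_left_idem[of ?P ?R] C by (simp only: closed)
  with PQ show ?thesis by simp
qed

text \<open>
  Factors between two equal letters commute. Since a word \<open>u\<close> equals \<open>u \<sqinter> u\<close>, the factors
  \<open>y, z\<close> of \<open>u = x \<sqinter> y \<sqinter> z \<sqinter> w\<close> get enclosed between two letters \<open>x\<close> in the first copy and between
  two letters \<open>w\<close> in the second, and can be exchanged in both.
\<close>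
lemma meet_normal:
  assumes C: "x \<in> carrier A" "y \<in> carrier A" "z \<in> carrier A" "w \<in> carrier A"
  shows "x \<sqinter> (y \<sqinter> (z \<sqinter> w)) = x \<sqinter> (z \<sqinter> (y \<sqinter> w))"
proof -
  have swap: "u \<sqinter> (v \<sqinter> (v' \<sqinter> u)) = u \<sqinter> (v' \<sqinter> (v \<sqinter> u))"
    if "u \<in> carrier A" "v \<in> carrier A" "v' \<in> carrier A" for u v v'
    using meet_insert_middle[of u v v'] meet_insert_middle[of u v' v] meet_commute_local[of u v v']
      that by simp
  have 1: "x \<sqinter> (y \<sqinter> (z \<sqinter> (w \<sqinter> x))) = x \<sqinter> (z \<sqinter> (y \<sqinter> (w \<sqinter> x)))"
  proof -
    have "x \<sqinter> (y \<sqinter> (z \<sqinter> (w \<sqinter> x))) = (x \<sqinter> (y \<sqinter> (z \<sqinter> x))) \<sqinter> (w \<sqinter> x)"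
      using meet_insert_middle[of x "y \<sqinter> z" w] C by (simp add: meet_assoc closed)
    also have "\<dots> = (x \<sqinter> (z \<sqinter> (y \<sqinter> x))) \<sqinter> (w \<sqinter> x)"
      using swap[of x y z] C by simp
    also have "\<dots> = x \<sqinter> (z \<sqinter> (y \<sqinter> (w \<sqinter> x)))"
      using meet_insert_middle[of x "z \<sqinter> y" w] C by (simp add: meet_assoc closed)
    finally show ?thesis .
  qed
  have 2: "w \<sqinter> (x \<sqinter> (y \<sqinter> (z \<sqinter> w))) = w \<sqinter> (x \<sqinter> (z \<sqinter> (y \<sqinter> w)))"
  proof -
    have "w \<sqinter> (x \<sqinter> (y \<sqinter> (z \<sqinter> w))) = w \<sqinter> (x \<sqinter> (w \<sqinter> (y \<sqinter> (z \<sqinter> w))))"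
      using meet_insert_middle[of w x "y \<sqinter> z"] C by (simp add: meet_assoc closed)
    also have "\<dots> = w \<sqinter> (x \<sqinter> (w \<sqinter> (z \<sqinter> (y \<sqinter> w))))"
      using swap[of w y z] C by simp
    also have "\<dots> = w \<sqinter> (x \<sqinter> (z \<sqinter> (y \<sqinter> w)))"
      using meet_insert_middle[of w x "z \<sqinter> y"] C by (simp add: meet_assoc closed)
    finally show ?thesis .
  qed
  have "x \<sqinter> (y \<sqinter> (z \<sqinter> w)) = (x \<sqinter> (y \<sqinter> (z \<sqinter> (w \<sqinter> x)))) \<sqinter> (y \<sqinter> (z \<sqinter> w))"
    using meet_idem[of "x \<sqinter> (y \<sqinter> (z \<sqinter> w))"] C by (simp add: meet_assoc closed)
  also have "\<dots> = x \<sqinter> (z \<sqinter> (y \<sqinter> (w \<sqinter> (x \<sqinter> (y \<sqinter> (z \<sqinter> w))))))"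
    unfolding 1 using C by (simp add: meet_assoc closed)
  also have "\<dots> = x \<sqinter> (z \<sqinter> (y \<sqinter> w))"
    unfolding 2 using meet_idem[of "x \<sqinter> (z \<sqinter> (y \<sqinter> w))"] C by (simp add: meet_assoc closed)
  finally show ?thesis .
qed

section \<open>Elements that decide other elements\<close>

lemma meet_local_zero:
  assumes C: "e \<in> carrier A" "t \<in> carrier A" and "e \<sqinter> (t \<sqinter> e) = \<zero>"
  shows "e \<sqinter> t = \<zero>" "t \<sqinter> e = \<zero>"
proof -
  have "e \<sqinter> t = (e \<sqinter> (t \<sqinter> e)) \<sqinter> t" "t \<sqinter> e = t \<sqinter> (e \<sqinter> (t \<sqinter> e))"
    using meet_idem[of "e \<sqinter> t"] meet_idem[of "t \<sqinter> e"] C by (simp_all add: meet_assoc closed)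
  then show "e \<sqinter> t = \<zero>" "t \<sqinter> e = \<zero>"
    using assms zero_meet meet_zero by simp_all
qed

lemma diff_below:
  assumes C: "s \<in> carrier A" "t \<in> carrier A"
  shows "s \<sqinter> (s \<setminus> t) = s \<setminus> t" "(s \<setminus> t) \<sqinter> s = s \<setminus> t"
proof -
  let ?m = "s \<sqinter> t \<sqinter> s"
  have m: "?m \<in> carrier A" "s \<setminus> t \<in> carrier A" using C by (simp_all add: closed)
  show "s \<sqinter> (s \<setminus> t) = s \<setminus> t"
    using meet_absorb2[OF m(2) m(1)] diff_join[OF C] by simp
  have "(s \<setminus> t) \<sqinter> (?m \<squnion> (s \<setminus> t)) = \<zero> \<squnion> (s \<setminus> t)"
    using meet_join_distrib[OF m(2) m] diff_meet2[OF C] meet_idem m by simp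
  then show "(s \<setminus> t) \<sqinter> s = s \<setminus> t"
    using diff_join[OF C] zero_join m by simp
qed

text \<open>
  An element \<open>e\<close> gives \<open>t\<close> a truth value if the part of \<open>t\<close> below \<open>e\<close> is all of \<open>e\<close> or nothing.
\<close>
definition decides :: "'a \<Rightarrow> 'a \<Rightarrow> bool" where
  "decides e t \<longleftrightarrow> e \<sqinter> (t \<sqinter> e) = e \<or> e \<sqinter> (t \<sqinter> e) = \<zero>"

lemma local_meet:
  assumes "e \<in> carrier A" "s \<in> carrier A" "t \<in> carrier A"
  shows "e \<sqinter> ((s \<sqinter> t) \<sqinter> e) = (e \<sqinter> (s \<sqinter> e)) \<sqinter> (e \<sqinter> (t \<sqinter> e))"
  using meet_insert_middle[of e s t] assms by (simp add: band_simps)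

lemma local_join:
  assumes "e \<in> carrier A" "s \<in> carrier A" "t \<in> carrier A"
  shows "e \<sqinter> ((s \<squnion> t) \<sqinter> e) = (e \<sqinter> (s \<sqinter> e)) \<squnion> (e \<sqinter> (t \<sqinter> e))"
  using assms by (simp add: join_meet_distrib meet_join_distrib closed)

text \<open>
  These are the truth tables of conjunction, disjunction and difference. They are written so that
  they also hold for \<open>e = \<zero>\<close>, where the two values coincide.
\<close>
lemma decided_meet:
  assumes "e \<in> carrier A" "s \<in> carrier A" "t \<in> carrier A" "decides e s" "decides e t"
  shows "e \<sqinter> ((s \<sqinter> t) \<sqinter> e) = (if e \<sqinter> (s \<sqinter> e) = \<zero> then \<zero> else e \<sqinter> (t \<sqinter> e))"
  using assms unfolding local_meet[OF assms(1-3)] decides_def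
  by (auto simp: zero_meet meet_zero meet_idem closed)

lemma decided_join:
  assumes "e \<in> carrier A" "s \<in> carrier A" "t \<in> carrier A" "decides e s" "decides e t"
  shows "e \<sqinter> ((s \<squnion> t) \<sqinter> e) = (if e \<sqinter> (s \<sqinter> e) = \<zero> then e \<sqinter> (t \<sqinter> e) else e)"
  using assms unfolding local_join[OF assms(1-3)] decides_def
  by (auto simp: zero_join join_zero join_idem closed)

lemma decided_diff:
  assumes C: "e \<in> carrier A" "s \<in> carrier A" "t \<in> carrier A" and d: "decides e s" "decides e t"
  shows "e \<sqinter> ((s \<setminus> t) \<sqinter> e) = (if e \<sqinter> (t \<sqinter> e) = \<zero> then e \<sqinter> (s \<sqinter> e) else \<zero>)"
proof -
  let ?m = "s \<sqinter> t \<sqinter> s" and ?d = "s \<setminus> t"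
  let ?s = "e \<sqinter> (s \<sqinter> e)" and ?t = "e \<sqinter> (t \<sqinter> e)"
  have m: "?m \<in> carrier A" "?d \<in> carrier A" using C by (simp_all add: closed)
  have em: "e \<sqinter> (?m \<sqinter> e) = ?s \<sqinter> ?t \<sqinter> ?s"
    using C by (simp add: local_meet closed)
  have split: "?s = e \<sqinter> (?m \<sqinter> e) \<squnion> e \<sqinter> (?d \<sqinter> e)"
    using local_join[OF C(1) m] diff_join[OF C(2,3)] by simp
  have disj: "(e \<sqinter> (?m \<sqinter> e)) \<sqinter> (e \<sqinter> (?d \<sqinter> e)) = \<zero>"
    using local_meet[OF C(1) m] diff_meet1[OF C(2,3)] C by (simp add: zero_meet meet_zero)
  consider "?t = \<zero>" | "?t \<noteq> \<zero>" "?t = e" "?s = \<zero>" | "?t \<noteq> \<zero>" "?t = e" "?s = e"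
    using d by (auto simp: decides_def)
  then show ?thesis
  proof cases
    case 1
    then have "e \<sqinter> (?m \<sqinter> e) = \<zero>" using em C by (simp add: zero_meet meet_zero closed)
    then show ?thesis using split 1 C m by (simp add: zero_join closed)
  next
    case 2
    then have "e \<sqinter> (?m \<sqinter> e) = \<zero>" using em C by (simp add: zero_meet meet_zero closed)
    then show ?thesis using split 2 C m by (simp add: zero_join closed)
  next
    case 3
    then have "e \<sqinter> (?m \<sqinter> e) = e" using em C by (simp add: meet_idem)
    then show ?thesis using disj 3 C m by (simp add: band_simps)
  qed
qed

lemma decides_closed:
  assumes "e \<in> carrier A" "s \<in> carrier A" "t \<in> carrier A" "decides e s" "decides e t"
  shows "decides e (s \<sqinter> t)" "decides e (s \<squnion> t)" "decides e (s \<setminus> t)"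
  using decided_meet[OF assms] decided_join[OF assms] decided_diff[OF assms] assms(4,5)
  by (auto simp: decides_def)

lemma atom_iff_decides:
  "e \<in> atoms A \<longleftrightarrow> e \<in> carrier A \<and> e \<noteq> \<zero> \<and> (\<forall>t \<in> carrier A. decides e t)"
proof
  assume a: "e \<in> atoms A"
  then have e: "e \<in> carrier A" "e \<noteq> \<zero>" by (simp_all add: atoms_def)
  have "decides e t" if t: "t \<in> carrier A" for t
  proof -
    have "nat_ge A e (e \<sqinter> (t \<sqinter> e))"
      using e t by (simp add: nat_ge_def band_simps)
    then show ?thesis
      using a e t unfolding atoms_def decides_def by (auto simp: closed)
  qed
  with e show "e \<in> carrier A \<and> e \<noteq> \<zero> \<and> (\<forall>t \<in> carrier A. decides e t)" by simp
next
  assume e: "e \<in> carrier A \<and> e \<noteq> \<zero> \<and> (\<forall>t \<in> carrier A. decides e t)"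
  have "b = e" if "b \<in> carrier A" "b \<noteq> \<zero>" "nat_ge A e b" for b
  proof -
    have "e \<sqinter> (b \<sqinter> e) = b" using that by (simp add: nat_ge_def)
    then show ?thesis using e that by (auto simp: decides_def)
  qed
  then show "e \<in> atoms A" using e by (auto simp: atoms_def)
qed

text \<open>
  In the rectangular class of \<open>a\<close>, a meet takes its row from the left factor and its column from
  the right one. A factor between the two, as long as it lies above that class, leaves no trace.
\<close>
lemma decided_one_sided:
  assumes C: "a \<in> carrier A" "t \<in> carrier A" "s \<in> carrier A" and "a \<sqinter> (t \<sqinter> a) = a"
  shows "s \<sqinter> (t \<sqinter> a) = s \<sqinter> a" "a \<sqinter> (t \<sqinter> s) = a \<sqinter> s"
proof -
  have "s \<sqinter> a = s \<sqinter> (a \<sqinter> (t \<sqinter> a))" "a \<sqinter> s = a \<sqinter> (t \<sqinter> (a \<sqinter> s))"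
    using assms meet_assoc[of a "t \<sqinter> a" s] by (simp_all add: meet_assoc closed)
  then show "s \<sqinter> (t \<sqinter> a) = s \<sqinter> a" "a \<sqinter> (t \<sqinter> s) = a \<sqinter> s"
    using meet_normal[of s a t a] meet_normal[of a t a s] C by (simp_all add: band_simps)
qed

end

section \<open>Finitely generated algebras\<close>

locale generated_sba = skew_boolean_algebra +
  fixes I :: "'v set" and x :: "'v \<Rightarrow> 'a"
  assumes finite_index: "finite I"
    and generator_closed: "k \<in> I \<Longrightarrow> x k \<in> carrier A"
    and generated: "carrier A = sba_eval A x ` {t. vars t \<subseteq> I}"
begin

lemma generated_induct [consumes 1, case_names gen zero meet join diff]:
  assumes "t \<in> carrier A"
    and gen: "\<And>k. k \<in> I \<Longrightarrow> P (x k)" and zero: "P \<zero>"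
    and step: "\<And>s t. \<lbrakk>s \<in> carrier A; t \<in> carrier A; P s; P t\<rbrakk> \<Longrightarrow> P (s \<sqinter> t)"
      "\<And>s t. \<lbrakk>s \<in> carrier A; t \<in> carrier A; P s; P t\<rbrakk> \<Longrightarrow> P (s \<squnion> t)"
      "\<And>s t. \<lbrakk>s \<in> carrier A; t \<in> carrier A; P s; P t\<rbrakk> \<Longrightarrow> P (s \<setminus> t)"
  shows "P t"
proof -
  have "P (sba_eval A x u)" if "vars u \<subseteq> I" for u
    using that
    by (induction u) (auto simp: generated intro!: gen zero step)
  then show ?thesis using assms(1) by (auto simp: generated)
qed

definition supp :: "'a \<Rightarrow> 'v set" where
  "supp e = {k \<in> I. e \<sqinter> (x k \<sqinter> e) = e}"

lemma supp_iff: "k \<in> supp e \<longleftrightarrow> k \<in> I \<and> e \<sqinter> (x k \<sqinter> e) = e"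
  by (simp add: supp_def)

lemma atom_if_decides_generators:
  assumes "e \<in> carrier A" "e \<noteq> \<zero>" "\<And>k. k \<in> I \<Longrightarrow> decides e (x k)"
  shows "e \<in> atoms A"
proof -
  have "decides e t" if "t \<in> carrier A" for t
    using that
    by (induction t rule: generated_induct)
      (use assms decides_closed in \<open>auto simp: decides_def zero_meet meet_zero\<close>)
  then show ?thesis using assms by (simp add: atom_iff_decides)
qed

text \<open>
  Truth values are computed from those of the generators. So \<open>a\<close> and \<open>b\<close> give the same value to
  every element, in particular to \<open>b\<close>, which \<open>b\<close> makes true.
\<close>
lemma atoms_same_supp:
  assumes a: "a \<in> atoms A" and b: "b \<in> atoms A" and ab: "supp a = supp b"
  shows "a \<sqinter> (b \<sqinter> a) = a"
proof -
  note A = a[unfolded atom_iff_decides] and B = b[unfolded atom_iff_decides]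
  have nz: "e \<sqinter> (t \<sqinter> e) = e \<longleftrightarrow> e \<sqinter> (t \<sqinter> e) \<noteq> \<zero>"
    if "e = a \<or> e = b" "t \<in> carrier A" for e t
    using A B that by (auto simp: decides_def)
  have "a \<sqinter> (t \<sqinter> a) = \<zero> \<longleftrightarrow> b \<sqinter> (t \<sqinter> b) = \<zero>" if "t \<in> carrier A" for t
    using that
  proof (induction t rule: generated_induct)
    case (gen k)
    then show ?case using ab supp_iff[of k a] supp_iff[of k b] nz generator_closed by metis
  next
    case zero
    then show ?case using A B by (simp add: zero_meet meet_zero)
  qed (use A B in \<open>simp_all add: decided_meet decided_join decided_diff\<close>)
  moreover have "b \<sqinter> (b \<sqinter> b) \<noteq> \<zero>" using B by (simp add: meet_idem)
  ultimately show ?thesis using nz B by blast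
qed

text \<open>
  Every element \<open>t\<close> that \<open>a\<close> makes true has the row and the column of a generator: a meet has the
  row of its left and the column of its right factor, a join of two true elements has them the
  other way round, and false arguments have no influence.
\<close>
lemma atom_meets_generator:
  assumes a: "a \<in> atoms A" and t: "t \<in> carrier A" and "a \<sqinter> (t \<sqinter> a) \<noteq> \<zero>"
  shows "(\<exists>i \<in> supp a. t \<sqinter> a = x i \<sqinter> a) \<and> (\<exists>j \<in> supp a. a \<sqinter> t = a \<sqinter> x j)"
proof -
  have A: "a \<in> carrier A" "a \<noteq> \<zero>" and dec: "\<And>t. t \<in> carrier A \<Longrightarrow> decides a t"
    using a by (simp_all add: atom_iff_decides)
  have nz: "a \<sqinter> (s \<sqinter> a) = a" if "s \<in> carrier A" "a \<sqinter> (s \<sqinter> a) \<noteq> \<zero>" for s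
    using dec that by (auto simp: decides_def)
  show ?thesis
    using t \<open>a \<sqinter> (t \<sqinter> a) \<noteq> \<zero>\<close>
  proof (induction t rule: generated_induct)
    case (gen k)
    then have "k \<in> supp a" using nz generator_closed by (simp add: supp_iff)
    then show ?case by blast
  next
    case zero
    then show ?case using A by (simp add: zero_meet meet_zero)
  next
    case (meet s t)
    note C = A(1) meet.hyps
    have ne: "a \<sqinter> (s \<sqinter> a) \<noteq> \<zero>" "a \<sqinter> (t \<sqinter> a) \<noteq> \<zero>"
      using decided_meet[OF C dec dec] C meet.prems by (auto split: if_splits)
    have "(s \<sqinter> t) \<sqinter> a = s \<sqinter> a" "a \<sqinter> (s \<sqinter> t) = a \<sqinter> t"
      using decided_one_sided(1)[OF C(1,3,2) nz] decided_one_sided(2)[OF C nz] ne C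
      by (simp_all add: meet_assoc)
    then show ?case using meet.IH ne by simp
  next
    case (join s t)
    note C = A(1) join.hyps
    have dist: "(s \<squnion> t) \<sqinter> a = s \<sqinter> a \<squnion> t \<sqinter> a" "a \<sqinter> (s \<squnion> t) = a \<sqinter> s \<squnion> a \<sqinter> t"
      using C by (simp_all add: join_meet_distrib meet_join_distrib)
    consider "a \<sqinter> (s \<sqinter> a) = \<zero>" | "a \<sqinter> (s \<sqinter> a) \<noteq> \<zero>" "a \<sqinter> (t \<sqinter> a) = \<zero>"
      | "a \<sqinter> (s \<sqinter> a) \<noteq> \<zero>" "a \<sqinter> (t \<sqinter> a) \<noteq> \<zero>" by blast
    then show ?case
    proof cases
      case 1
      then have "a \<sqinter> (t \<sqinter> a) \<noteq> \<zero>"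
        using decided_join[OF C dec dec] C join.prems by simp
      moreover have "(s \<squnion> t) \<sqinter> a = t \<sqinter> a" "a \<sqinter> (s \<squnion> t) = a \<sqinter> t"
        using meet_local_zero[OF C(1,2) 1] dist C by (simp_all add: zero_join closed)
      ultimately show ?thesis using join.IH(2) by simp
    next
      case 2
      then have "(s \<squnion> t) \<sqinter> a = s \<sqinter> a" "a \<sqinter> (s \<squnion> t) = a \<sqinter> s"
        using meet_local_zero[OF C(1,3)] dist C by (simp_all add: join_zero closed)
      then show ?thesis using join.IH(1) 2 by simp
    next
      case 3
      have "s \<sqinter> (t \<sqinter> a) = s \<sqinter> a" "a \<sqinter> s \<sqinter> t = a \<sqinter> t"
        using decided_one_sided(1)[OF C(1,3,2) nz] decided_one_sided(2)[OF C nz] 3 C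
        by (simp_all add: meet_assoc)
      then have "(s \<squnion> t) \<sqinter> a = t \<sqinter> a" "a \<sqinter> (s \<squnion> t) = a \<sqinter> s"
        using join_absorb2[of "t \<sqinter> a" s] join_absorb1[of "a \<sqinter> s" t] dist C
        by (simp_all add: closed)
      then show ?thesis using join.IH 3 by simp
    qed
  next
    case (diff s t)
    note C = A(1) diff.hyps
    have st: "a \<sqinter> (t \<sqinter> a) = \<zero>" "a \<sqinter> (s \<sqinter> a) \<noteq> \<zero>"
      using decided_diff[OF C dec dec] C diff.prems by (auto split: if_splits)
    let ?m = "s \<sqinter> t \<sqinter> s"
    have m: "?m \<in> carrier A" "s \<setminus> t \<in> carrier A" using C by (simp_all add: closed)
    have "a \<sqinter> (?m \<sqinter> a) = \<zero>"
      using st(1) C by (simp add: local_meet closed zero_meet meet_zero)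
    then have "?m \<sqinter> a = \<zero>" "a \<sqinter> ?m = \<zero>"
      using meet_local_zero[OF C(1) m(1)] by simp_all
    then have "(s \<setminus> t) \<sqinter> a = (?m \<squnion> (s \<setminus> t)) \<sqinter> a" "a \<sqinter> (s \<setminus> t) = a \<sqinter> (?m \<squnion> (s \<setminus> t))"
      using join_meet_distrib[OF m C(1)] meet_join_distrib[OF C(1) m] m C
      by (simp_all add: zero_join closed)
    then show ?case using diff_join[OF C(2,3)] diff.IH(1) st by simp
  qed
qed

text \<open>
  The generator \<open>x i\<close> has the row of \<open>a\<close>, and \<open>x j\<close> has its column.
\<close>
definition labelled :: "'a \<Rightarrow> 'v set \<Rightarrow> 'v \<Rightarrow> 'v \<Rightarrow> bool" where
  "labelled a S i j \<longleftrightarrow>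
    a \<in> atoms A \<and> supp a = S \<and> i \<in> S \<and> j \<in> S \<and> x i \<sqinter> a = a \<and> a \<sqinter> x j = a"

lemma atom_has_label:
  assumes "a \<in> atoms A"
  shows "\<exists>i j. labelled a (supp a) i j"
proof -
  have a: "a \<in> carrier A" "a \<noteq> \<zero>" using assms by (simp_all add: atom_iff_decides)
  then show ?thesis
    using atom_meets_generator[OF assms a(1)] assms unfolding labelled_def
    by (metis meet_idem)
qed

text \<open>
  Both atoms equal \<open>x i \<sqinter> a \<sqinter> b \<sqinter> x j\<close>: they absorb each other because they have the same support,
  and the outer factors allow the inner ones to be permuted.
\<close>
lemma labelled_unique:
  assumes a: "labelled a S i j" and b: "labelled b S i j"
  shows "a = b"
proof -
  have A: "a \<in> atoms A" "a \<in> carrier A" "x i \<sqinter> a = a" "a \<sqinter> x j = a"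
    and B: "b \<in> atoms A" "b \<in> carrier A" "x i \<sqinter> b = b" "b \<sqinter> x j = b"
    and S: "supp a = supp b" and ij: "x i \<in> carrier A" "x j \<in> carrier A"
    using a b generator_closed by (auto simp: labelled_def atom_iff_decides supp_iff)
  have "a = a \<sqinter> (b \<sqinter> a)" using atoms_same_supp[OF A(1) B(1) S] by simp
  also have "\<dots> = x i \<sqinter> (a \<sqinter> (b \<sqinter> (a \<sqinter> x j)))"
    using A(4) meet_assoc[OF ij(1) A(2), of "b \<sqinter> a"] A(2,3) B(2) by (simp add: closed)
  also have "\<dots> = x i \<sqinter> (b \<sqinter> (a \<sqinter> (b \<sqinter> x j)))"
    using meet_normal[of "x i" a b "a \<sqinter> x j"] meet_normal[of "x i" b a "b \<sqinter> x j"]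
      meet_normal[of "x i" a b "x j"] A(2) B(2) ij by (simp add: band_simps)
  also have "\<dots> = b \<sqinter> (a \<sqinter> b)"
    using B(4) meet_assoc[OF ij(1) B(2), of "a \<sqinter> b"] B(2,3) A(2) by (simp add: closed)
  also have "\<dots> = b" using atoms_same_supp[OF B(1) A(1) S[symmetric]] .
  finally show ?thesis .
qed

end

section \<open>Separating atoms by homomorphisms to rectangular algebras\<close>

text \<open>
  The primitive skew Boolean algebra whose only nonzero class is the rectangular band \<open>P \<times> Q\<close>, with
  \<open>None\<close> as its zero. It is left-handed if \<open>Q\<close> is a singleton and right-handed if \<open>P\<close> is one.
\<close>
definition rect_alg :: "'b set \<Rightarrow> 'c set \<Rightarrow> ('b \<times> 'c) option skew_alg" where
  "rect_alg P Q =
    \<lparr> carrier = insert None (Some ` (P \<times> Q)),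
      meet = (\<lambda>s t. case s of None \<Rightarrow> None | Some u \<Rightarrow>
        (case t of None \<Rightarrow> None | Some v \<Rightarrow> Some (fst u, snd v))),
      join = (\<lambda>s t. case s of None \<Rightarrow> t | Some u \<Rightarrow>
        (case t of None \<Rightarrow> s | Some v \<Rightarrow> Some (fst v, snd u))),
      diff = (\<lambda>s t. if t = None then s else None),
      zero = None \<rparr>"

lemma rect_alg_simps [simp]:
  "carrier (rect_alg P Q) = insert None (Some ` (P \<times> Q))"
  "zero (rect_alg P Q) = None"
  "None \<sqinter>\<^bsub>rect_alg P Q\<^esub> t = None" "s \<sqinter>\<^bsub>rect_alg P Q\<^esub> None = None"
  "Some u \<sqinter>\<^bsub>rect_alg P Q\<^esub> Some v = Some (fst u, snd v)"
  "None \<squnion>\<^bsub>rect_alg P Q\<^esub> t = t" "s \<squnion>\<^bsub>rect_alg P Q\<^esub> None = s"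
  "Some u \<squnion>\<^bsub>rect_alg P Q\<^esub> Some v = Some (fst v, snd u)"
  "s \<setminus>\<^bsub>rect_alg P Q\<^esub> None = s" "s \<setminus>\<^bsub>rect_alg P Q\<^esub> Some v = None"
  by (simp_all add: rect_alg_def split: option.splits)

lemma skew_boolean_rect_alg: "skew_boolean_algebra (rect_alg P Q)"
  by unfold_locales auto

lemma left_handed_rect_alg: "left_handed_sba (rect_alg P {c})"
  by (intro left_handed_sba.intro skew_boolean_rect_alg, unfold_locales) auto

lemma right_handed_rect_alg: "right_handed_sba (rect_alg {c} Q)"
  by (intro right_handed_sba.intro skew_boolean_rect_alg, unfold_locales) auto

lemma rect_meet_eq_None [simp]:
  "s \<sqinter>\<^bsub>rect_alg P Q\<^esub> t = None \<longleftrightarrow> s = None \<or> t = None"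
  by (cases s; cases t) auto

lemma alg_homD:
  assumes "h \<in> alg_hom A B" "s \<in> carrier A" "t \<in> carrier A"
  shows "h (s \<sqinter>\<^bsub>A\<^esub> t) = h s \<sqinter>\<^bsub>B\<^esub> h t" "h (s \<setminus>\<^bsub>A\<^esub> t) = h s \<setminus>\<^bsub>B\<^esub> h t"
    "h \<zero>\<^bsub>A\<^esub> = \<zero>\<^bsub>B\<^esub>"
  using assms by (simp_all add: alg_hom_def)

context generated_sba
begin

text \<open>
  Start with a generator in \<open>S\<close> and pass through all \<open>k \<in> I\<close>, replacing \<open>e\<close> by its part inside
  \<open>x k\<close> if \<open>k \<in> S\<close> and by its part outside otherwise. Values that are decided stay decided when
  \<open>e\<close> shrinks, and \<open>h\<close> certifies that no step ends in zero.
\<close>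
lemma ex_cell:
  assumes h: "h \<in> alg_hom A (rect_alg P Q)" "\<And>k. k \<in> I \<Longrightarrow> h (x k) = None \<longleftrightarrow> k \<notin> S"
    and S: "S \<subseteq> I" "S \<noteq> {}"
  shows "\<exists>e \<in> carrier A. h e \<noteq> None \<and>
    (\<forall>k \<in> I. e \<sqinter> (x k \<sqinter> e) = (if k \<in> S then e else \<zero>))"
proof -
  have "\<exists>e \<in> carrier A. h e \<noteq> None \<and>
    (\<forall>k \<in> J. e \<sqinter> (x k \<sqinter> e) = (if k \<in> S then e else \<zero>))" if "J \<subseteq> I" for J
    using finite_subset[OF that finite_index] that
  proof (induction J rule: finite_induct)
    case empty
    obtain i where "i \<in> S" using S by blast
    then have "i \<in> I" using S by blast
    then have "x i \<in> carrier A" "h (x i) \<noteq> None" using h(2) \<open>i \<in> S\<close> generator_closed by blast+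
    then show ?case by blast
  next
    case (insert k J)
    then obtain e where e: "e \<in> carrier A" "h e \<noteq> None"
      and J: "\<And>l. l \<in> J \<Longrightarrow> e \<sqinter> (x l \<sqinter> e) = (if l \<in> S then e else \<zero>)" by auto
    have k: "k \<in> I" "x k \<in> carrier A" using insert.prems generator_closed by auto
    \<comment> \<open>Passing to a smaller element keeps the values that are already fixed.\<close>
    have shrink: "f \<sqinter> (x l \<sqinter> f) = (if l \<in> S then f else \<zero>)"
      if "l \<in> J" "f \<in> carrier A" "e \<sqinter> f = f" "f \<sqinter> e = f" for f l
    proof -
      have l: "x l \<in> carrier A" using that insert.prems generator_closed by auto
      have "f \<sqinter> (x l \<sqinter> f) = (f \<sqinter> e) \<sqinter> (x l \<sqinter> (e \<sqinter> f))" using that by simp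
      also have "\<dots> = f \<sqinter> ((e \<sqinter> (x l \<sqinter> e)) \<sqinter> f)" using that(2) e(1) l by (simp add: meet_assoc closed)
      finally show ?thesis
        using J[OF that(1)] that by (auto simp: zero_meet meet_zero meet_idem)
    qed
    show ?case
    proof (cases "k \<in> S")
      case True
      let ?f = "e \<sqinter> (x k \<sqinter> e)"
      have f: "?f \<in> carrier A" "e \<sqinter> ?f = ?f" "?f \<sqinter> e = ?f"
        using e k by (simp_all add: band_simps)
      have "h ?f \<noteq> None"
        using alg_homD[OF h(1)] e k h(2)[OF k(1)] True by (simp add: closed)
      moreover have "?f \<sqinter> (x k \<sqinter> ?f) = ?f"
      proof -
        let ?w = "e \<sqinter> x k"
        have w: "?w \<in> carrier A" using e k by (simp add: closed)
        have "?f \<sqinter> (x k \<sqinter> ?f) = ?w \<sqinter> (?w \<sqinter> (?w \<sqinter> e))"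
          using e k by (simp add: meet_assoc closed)
        also have "\<dots> = ?w \<sqinter> e" using w e(1) by (simp only: meet_left_idem)
        finally show ?thesis using e k by (simp add: meet_assoc)
      qed
      then have "\<forall>l \<in> insert k J. ?f \<sqinter> (x l \<sqinter> ?f) = (if l \<in> S then ?f else \<zero>)"
        using shrink[OF _ f] True by simp
      ultimately show ?thesis using f(1) by blast
    next
      case False
      let ?f = "e \<setminus> x k" and ?m = "e \<sqinter> x k \<sqinter> e"
      have f: "?f \<in> carrier A" "e \<sqinter> ?f = ?f" "?f \<sqinter> e = ?f"
        using e k diff_below by (simp_all add: closed)
      have "h ?f \<noteq> None"
        using alg_homD[OF h(1)] e k h(2)[OF k(1)] False by simp
      moreover have "?f \<sqinter> (x k \<sqinter> ?f) = \<zero>"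
      proof -
        have "?f \<sqinter> (x k \<sqinter> ?f) = (?f \<sqinter> e) \<sqinter> (x k \<sqinter> (e \<sqinter> ?f))" using f by simp
        also have "\<dots> = (?f \<sqinter> ?m) \<sqinter> ?f" using e k f(1) by (simp add: meet_assoc closed)
        also have "\<dots> = \<zero>" using diff_meet2[OF e(1) k(2)] f(1) by (simp add: zero_meet)
        finally show ?thesis .
      qed
      then have "\<forall>l \<in> insert k J. ?f \<sqinter> (x l \<sqinter> ?f) = (if l \<in> S then ?f else \<zero>)"
        using shrink[OF _ f] False by simp
      ultimately show ?thesis using f(1) by blast
    qed
  qed
  then show ?thesis by blast
qed

text \<open>
  The element of the previous lemma has the right support; multiplying it by \<open>x i\<close> and \<open>x j\<close> moves
  it to the right row and column without leaving its class.
\<close>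
lemma ex_labelled:
  assumes h: "h \<in> alg_hom A (rect_alg P Q)" "\<And>k. k \<in> I \<Longrightarrow> h (x k) = None \<longleftrightarrow> k \<notin> S"
    and S: "S \<subseteq> I" "i \<in> S" "j \<in> S"
  shows "\<exists>a. labelled a S i j \<and> h a \<noteq> None"
proof -
  obtain e where e: "e \<in> carrier A" "h e \<noteq> None"
    and dec: "\<And>k. k \<in> I \<Longrightarrow> e \<sqinter> (x k \<sqinter> e) = (if k \<in> S then e else \<zero>)"
    using ex_cell[OF h] S by blast
  have ij: "i \<in> I" "j \<in> I" "x i \<in> carrier A" "x j \<in> carrier A"
    using S generator_closed by auto
  let ?a = "x i \<sqinter> (e \<sqinter> x j)"
  have a: "?a \<in> carrier A" using e ij by (simp add: closed)
  have ha: "h ?a \<noteq> None"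
    using alg_homD[OF h(1)] e ij h(2) S by (simp add: closed)
  then have nz: "?a \<noteq> \<zero>" using alg_homD(3)[OF h(1) a a] by auto
  have loc: "?a \<sqinter> (x k \<sqinter> ?a) = (if k \<in> S then ?a else \<zero>)" if k: "k \<in> I" for k
  proof -
    have xk: "x k \<in> carrier A" using k generator_closed by simp
    have "?a \<sqinter> (x k \<sqinter> ?a) = x i \<sqinter> ((e \<sqinter> ((x j \<sqinter> (x k \<sqinter> x i)) \<sqinter> e)) \<sqinter> x j)"
      using e xk ij by (simp add: meet_assoc closed)
    also have "e \<sqinter> ((x j \<sqinter> (x k \<sqinter> x i)) \<sqinter> e) = (if k \<in> S then e else \<zero>)"
      using e xk ij dec S k
      by (simp add: local_meet closed meet_idem zero_meet meet_zero)
    finally show ?thesis using e ij by (simp add: zero_meet meet_zero)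
  qed
  then have "?a \<in> atoms A"
    using a nz by (intro atom_if_decides_generators) (auto simp: decides_def)
  moreover have "supp ?a = S" using loc nz S by (auto simp: supp_iff split: if_splits)
  ultimately have "labelled ?a S i j"
    unfolding labelled_def using S ij e by (simp add: band_simps)
  then show ?thesis using ha by blast
qed

end

text \<open>
  The consequence of freeness that the count depends on. The functions \<open>p\<close> and \<open>q\<close> give the row and
  the column of the image of a generator. They are injective if the algebra is free among all skew
  Boolean algebras; in a one-sided variety one of them has to be constant.
\<close>
locale separated_sba = generated_sba A I x
  for A :: "'a skew_alg" (structure) and I :: "'v set" and x +
  fixes p :: "'v \<Rightarrow> 'b" and q :: "'v \<Rightarrow> 'c"
  assumes ex_hom: "\<exists>P Q. \<exists>h \<in> alg_hom A (rect_alg P Q).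
    \<forall>k \<in> I. h (x k) = (if k \<in> S then Some (p k, q k) else None)"
begin

lemma ex_atom:
  assumes "S \<subseteq> I" "i \<in> S" "j \<in> S"
  shows "\<exists>a. labelled a S i j"
proof -
  obtain P Q h where "h \<in> alg_hom A (rect_alg P Q)"
    "\<forall>k \<in> I. h (x k) = (if k \<in> S then Some (p k, q k) else None)"
    using ex_hom by blast
  then have "\<exists>a. labelled a S i j \<and> h a \<noteq> None" using assms by (intro ex_labelled) simp_all
  then show ?thesis by blast
qed

lemma label_unique:
  assumes a: "labelled a S i j" and a': "labelled a S' i' j'"
  shows "S = S'" "p i = p i'" "q j = q j'"
proof -
  show S: "S = S'" using a a' by (simp add: labelled_def)
  have lab: "S \<subseteq> I" "i \<in> S" "j \<in> S" "i' \<in> S" "j' \<in> S"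
    and C: "a \<in> carrier A" "x i \<in> carrier A" "x j \<in> carrier A" "x i' \<in> carrier A" "x j' \<in> carrier A"
    and eq: "x i \<sqinter> a = a" "a \<sqinter> x j = a" "x i' \<sqinter> a = a" "a \<sqinter> x j' = a"
    using a a' generator_closed unfolding labelled_def supp_def by (auto simp: atom_iff_decides)
  obtain P Q h where h: "h \<in> alg_hom A (rect_alg P Q)"
    and hx: "\<And>k. k \<in> I \<Longrightarrow> h (x k) = (if k \<in> S then Some (p k, q k) else None)"
    using ex_hom[of S] by blast
  \<comment> \<open>Uniqueness identifies \<open>a\<close> with an atom that \<open>h\<close> does not annihilate, so that its label can be
    read off from its image.\<close>
  obtain b where "labelled b S i j" "h b \<noteq> None"
    using ex_labelled[OF h _ lab(1-3)] hx by (metis option.distinct(1))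
  then obtain u v where ha: "h a = Some (u, v)"
    using labelled_unique[OF a] by auto
  have hx': "h (x k) = Some (p k, q k)" if "k \<in> S" for k
    using hx that lab by auto
  show "p i = p i'" "q j = q j'"
    using alg_homD(1)[OF h C(2) C(1)] alg_homD(1)[OF h C(1) C(3)]
      alg_homD(1)[OF h C(4) C(1)] alg_homD(1)[OF h C(1) C(5)] eq ha lab hx' by simp_all
qed

text \<open>
  \<open>L S\<close> is a set of representatives for the pairs \<open>(i, j)\<close> that can label an atom with support \<open>S\<close>;
  it is \<open>S \<times> S\<close> in general and the diagonal in the one-sided cases.
\<close>
lemma card_atoms:
  assumes L: "\<And>a S i j. labelled a S i j \<Longrightarrow> \<exists>(i', j') \<in> L S. labelled a S i' j'"
    and sub: "\<And>S. S \<subseteq> I \<Longrightarrow> L S \<subseteq> S \<times> S"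
    and inj: "\<And>S. S \<subseteq> I \<Longrightarrow> inj_on (map_prod p q) (L S)"
  shows "card (atoms A) = (\<Sum>S \<in> Pow I. card (L S))"
proof -
  define f where "f = (\<lambda>(S, i, j). SOME a. labelled a S i j)"
  have f: "labelled (f (S, i, j)) S i j" if "S \<subseteq> I" "(i, j) \<in> L S" for S i j
  proof -
    have "i \<in> S" "j \<in> S" using sub that by auto
    then show ?thesis using someI_ex[OF ex_atom[OF that(1)]] by (simp add: f_def)
  qed
  have "inj_on f (Sigma (Pow I) L)"
  proof (rule inj_onI, clarsimp)
    fix S i j S' i' j'
    assume *: "S \<subseteq> I" "(i, j) \<in> L S" "S' \<subseteq> I" "(i', j') \<in> L S'" "f (S, i, j) = f (S', i', j')"
    have "labelled (f (S', i', j')) S i j" using f[OF *(1,2)] *(5) by simp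
    from label_unique[OF this f[OF *(3,4)]]
    have "S = S'" "map_prod p q (i, j) = map_prod p q (i', j')" by auto
    then show "S = S' \<and> i = i' \<and> j = j'"
      using *(1,2,4) inj_onD[OF inj[OF *(1)], of "(i, j)" "(i', j')"] by simp
  qed
  moreover have "f ` Sigma (Pow I) L = atoms A"
  proof
    show "f ` Sigma (Pow I) L \<subseteq> atoms A" using f by (auto simp: labelled_def)
    show "atoms A \<subseteq> f ` Sigma (Pow I) L"
    proof
      fix a assume "a \<in> atoms A"
      then obtain i j where ij: "(i, j) \<in> L (supp a)" "labelled a (supp a) i j"
        using atom_has_label L by (metis (no_types, lifting) case_prodE)
      moreover have "supp a \<subseteq> I" by (auto simp: supp_def)
      ultimately show "a \<in> f ` Sigma (Pow I) L"
        using labelled_unique f by (metis PowI SigmaI image_eqI)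
    qed
  qed
  ultimately have "card (atoms A) = card (Sigma (Pow I) L)"
    using card_image by metis
  moreover have "finite (L S)" if "S \<in> Pow I" for S
    using sub that finite_index by (meson PowD finite_SigmaI finite_subset)
  ultimately show ?thesis using finite_index by simp
qed

lemma card_atoms_general:
  assumes "inj_on p I" "inj_on q I"
  shows "card (atoms A) = (\<Sum>S \<in> Pow I. card S ^ 2)"
proof -
  have "card (atoms A) = (\<Sum>S \<in> Pow I. card (S \<times> S))"
  proof (rule card_atoms)
    show "inj_on (map_prod p q) (S \<times> S)" if "S \<subseteq> I" for S
      using assms that by (intro map_prod_inj_on) (auto intro: inj_on_subset)
  qed (auto simp: labelled_def)
  then show ?thesis by (simp add: card_cartesian_product power2_eq_square)
qed

lemma card_atoms_one_sided:
  assumes diag: "\<And>a S i j. labelled a S i j \<Longrightarrow> \<exists>k. labelled a S k k"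
    and inj: "inj_on p I \<or> inj_on q I"
  shows "card (atoms A) = (\<Sum>S \<in> Pow I. card S)"
proof -
  have "card (atoms A) = (\<Sum>S \<in> Pow I. card ((\<lambda>k. (k, k)) ` S))"
  proof (rule card_atoms)
    show "\<exists>(i', j') \<in> (\<lambda>k. (k, k)) ` S. labelled a S i' j'" if "labelled a S i j" for a S i j
      using diag[OF that] by (auto simp: labelled_def)
    show "inj_on (map_prod p q) ((\<lambda>k. (k, k)) ` S)" if "S \<subseteq> I" for S
      using inj that by (auto simp: inj_on_def)
  qed auto
  then show ?thesis by (simp add: card_image inj_on_def)
qed

text \<open>
  In a left-handed algebra \<open>a \<sqinter> x i = a \<sqinter> x i \<sqinter> a = a\<close> for all \<open>i\<close> in the support: an atom has every
  admissible column, so that the row generator also serves as the column generator.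
\<close>
lemma card_atoms_left:
  assumes "left_handed_sba A" "inj_on p I"
  shows "card (atoms A) = (\<Sum>S \<in> Pow I. card S)"
proof (rule card_atoms_one_sided)
  interpret L: left_handed_sba A by fact
  fix a S i j assume a: "labelled a S i j"
  then have "a \<sqinter> (x i \<sqinter> a) = a" "a \<in> carrier A" "x i \<in> carrier A"
    using generator_closed by (auto simp: labelled_def atom_iff_decides supp_def)
  then have "a \<sqinter> x i = a" using L.left_meet[of a "x i"] by (simp add: meet_assoc)
  then show "\<exists>k. labelled a S k k" using a by (auto simp: labelled_def)
qed (use assms in simp)

lemma card_atoms_right:
  assumes "right_handed_sba A" "inj_on q I"
  shows "card (atoms A) = (\<Sum>S \<in> Pow I. card S)"
proof (rule card_atoms_one_sided)
  interpret R: right_handed_sba A by fact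
  fix a S i j assume a: "labelled a S i j"
  then have "a \<sqinter> (x j \<sqinter> a) = a" "a \<in> carrier A" "x j \<in> carrier A"
    using generator_closed by (auto simp: labelled_def atom_iff_decides supp_def)
  then have "x j \<sqinter> a = a" using R.right_meet[of a "x j"] by (simp add: meet_assoc)
  then show "\<exists>k. labelled a S k k" using a by (auto simp: labelled_def)
qed (use assms in simp)

end

section \<open>Free algebras\<close>

text \<open>
  The congruence \<open>\<theta>\<close> witnesses that the family whose intersection is \<open>free_cong V X\<close> is nonempty;
  the intersection of the empty family would not be a congruence.
\<close>
lemma generated_free_alg:
  assumes F: "skew_boolean_algebra (free_alg V X)" and X: "finite X"
    and V: "congruence (term_alg X) \<theta>" "V (quot_alg (term_alg X) \<theta>)"
  shows "generated_sba (free_alg V X) X (free_gen V X)"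
proof -
  have "congruence (term_alg X) (free_cong V X)"
    unfolding free_cong_def using V by (intro congruence_Inter) auto
  note qs = quot_term_simps[OF this, folded free_alg_def]
  have "sba_eval (free_alg V X) (free_gen V X) t = free_cong V X `` {t}" if "vars t \<subseteq> X" for t
    using that by (induction t) (simp_all add: free_gen_def qs)
  then have "carrier (free_alg V X) = sba_eval (free_alg V X) (free_gen V X) ` {t. vars t \<subseteq> X}"
    by (simp add: qs(1))
  moreover have "free_gen V X k \<in> carrier (free_alg V X)" if "k \<in> X" for k
    using that by (auto simp: free_gen_def qs(1))
  ultimately show ?thesis
    using F X by (simp add: generated_sba_def generated_sba_axioms_def)
qed

text \<open>
  The homomorphisms come from the universal property, as soon as the variety contains the
  primitive algebra.
\<close>
lemma separated_free_alg:
  fixes p :: "'v \<Rightarrow> 'b" and q :: "'v \<Rightarrow> 'c"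
  assumes F: "skew_boolean_algebra (free_alg V X)" and X: "finite X"
    and ker: "\<And>f. f ` X \<subseteq> carrier (rect_alg P Q) \<Longrightarrow>
      V (quot_alg (term_alg X) (eval_ker X (rect_alg P Q) f))"
    and pq: "p ` X \<subseteq> P" "q ` X \<subseteq> Q"
  shows "separated_sba (free_alg V X) X (free_gen V X) p q"
proof -
  let ?f = "\<lambda>S k. if k \<in> S then Some (p k, q k) else None"
  have f: "?f S ` X \<subseteq> carrier (rect_alg P Q)" for S
    using pq by auto
  have "\<exists>h \<in> alg_hom (free_alg V X) (rect_alg P Q). \<forall>k \<in> X. h (free_gen V X k) = ?f S k" for S
    using free_alg_universal[where V = V, OF ker[OF f[of S]] skew_boolean_rect_alg[of P Q] f[of S]] by blast
  then show ?thesis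
    using generated_free_alg[OF F X congruence_eval_ker ker[OF f[of X]]]
    unfolding separated_sba_def separated_sba_axioms_def by blast
qed

lemma card_atoms_free:
  assumes X: "finite X"
  shows "card (atoms (free_alg left_handed_sba X)) = (\<Sum>S \<in> Pow X. card S)"
    and "card (atoms (free_alg right_handed_sba X)) = (\<Sum>S \<in> Pow X. card S)"
    and "card (atoms (free_alg skew_boolean_algebra X)) = (\<Sum>S \<in> Pow X. card S ^ 2)"
proof -
  have "separated_sba (free_alg left_handed_sba X) X (free_gen left_handed_sba X) id (\<lambda>_. ())"
    using free_alg_in_variety(2) X
    by (intro separated_free_alg[where P = UNIV and Q = "{()}"]
        quot_eval_ker(2) left_handed_rect_alg left_handed_sba.axioms(1)) auto
  then show "card (atoms (free_alg left_handed_sba X)) = (\<Sum>S \<in> Pow X. card S)"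
    using separated_sba.card_atoms_left free_alg_in_variety(2) inj_on_id by blast
  have "separated_sba (free_alg right_handed_sba X) X (free_gen right_handed_sba X) (\<lambda>_. ()) id"
    using free_alg_in_variety(3) X
    by (intro separated_free_alg[where P = "{()}" and Q = UNIV]
        quot_eval_ker(3) right_handed_rect_alg right_handed_sba.axioms(1)) auto
  then show "card (atoms (free_alg right_handed_sba X)) = (\<Sum>S \<in> Pow X. card S)"
    using separated_sba.card_atoms_right free_alg_in_variety(3) inj_on_id by blast
  have "separated_sba (free_alg skew_boolean_algebra X) X (free_gen skew_boolean_algebra X) id id"
    using free_alg_in_variety(1) X
    by (intro separated_free_alg[where P = UNIV and Q = UNIV]
        quot_eval_ker(1) skew_boolean_rect_alg) auto
  then show "card (atoms (free_alg skew_boolean_algebra X)) = (\<Sum>S \<in> Pow X. card S ^ 2)"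
    using separated_sba.card_atoms_general inj_on_id by blast
qed

section \<open>Summing over the subsets of a finite set\<close>

lemma sum_card_Pow:
  assumes "finite X"
  shows "2 * (\<Sum>S \<in> Pow X. card S) = card X * 2 ^ card X"
    and "4 * (\<Sum>S \<in> Pow X. card S ^ 2) = card X * (card X + 1) * 2 ^ card X"
proof -
  \<comment> \<open>The subsets of \<open>insert y X\<close> are those of \<open>X\<close>, with and without \<open>y\<close>.\<close>
  have step: "(\<Sum>S \<in> Pow (insert y X). f (card S)) =
      (\<Sum>S \<in> Pow X. f (card S)) + (\<Sum>S \<in> Pow X. f (Suc (card S)))"
    if y: "finite X" "y \<notin> X" for y and X :: "'a set" and f :: "nat \<Rightarrow> nat"
  proof -
    have "inj_on (insert y) (Pow X)"
      using y(2) by (auto simp: inj_on_def insert_ident)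
    moreover have "card (insert y S) = Suc (card S)" if "S \<subseteq> X" for S
      using y that finite_subset by (subst card_insert_disjoint) auto
    ultimately have "(\<Sum>S \<in> insert y ` Pow X. f (card S)) = (\<Sum>S \<in> Pow X. f (Suc (card S)))"
      by (simp add: sum.reindex)
    moreover have "Pow X \<inter> insert y ` Pow X = {}" using y by auto
    ultimately show ?thesis
      using y by (simp add: Pow_insert sum.union_disjoint)
  qed
  have 1: "2 * (\<Sum>S \<in> Pow X. card S) = card X * 2 ^ card X" if "finite X" for X :: "'a set"
    using that
  proof (induction X rule: finite_induct)
    case (insert y X)
    then show ?case
      using step[of X y "\<lambda>m. m"] by (simp add: sum_Suc card_Pow algebra_simps)
  qed simp
  show "2 * (\<Sum>S \<in> Pow X. card S) = card X * 2 ^ card X"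
    using assms by (rule 1)
  show "4 * (\<Sum>S \<in> Pow X. card S ^ 2) = card X * (card X + 1) * 2 ^ card X"
    using assms
  proof (induction X rule: finite_induct)
    case (insert y X)
    have "(\<Sum>S \<in> Pow X. Suc (card S) ^ 2) =
        (\<Sum>S \<in> Pow X. card S ^ 2) + 2 * (\<Sum>S \<in> Pow X. card S) + 2 ^ card X"
    proof -
      have "Suc m ^ 2 = m ^ 2 + 2 * m + 1" for m by (simp add: power2_eq_square)
      then show ?thesis
        using insert.hyps by (simp only: sum.distrib sum_distrib_left card_Pow sum_constant) simp
    qed
    then show ?case
      using step[OF insert.hyps, of "\<lambda>m. m ^ 2"] 1[OF insert.hyps(1)] insert
      by (simp add: algebra_simps)
  qed simp
qed

theorem corollary4p5:
  fixes n :: nat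
  assumes "n \<ge> 1"
  shows "alpha_L n = alpha_R n \<and> alpha_R n = n * 2 ^ (n - 1) \<and>
    real (alpha n) = real n * (real n + 1) * 2 powi (int n - 2) \<and>
    real (alpha n) = (real n + 1) / 2 * real (alpha_L n)"
proof -
  have 2: "(2::nat) ^ n = 2 * 2 ^ (n - 1)"
    using assms by (cases n) auto
  have LR: "alpha_L n = alpha_R n"
    and R: "2 * alpha_R n = n * 2 ^ n"
    and G: "4 * alpha n = n * (n + 1) * 2 ^ n"
    using card_atoms_free[of "{..<n}"] sum_card_Pow[of "{..<n}"]
    by (simp_all add: alpha_L_def alpha_R_def alpha_def)
  have "real (4 * alpha n) = real (n * (n + 1) * 2 ^ n)" "real (2 * alpha_L n) = real (n * 2 ^ n)"
    using LR R G by simp_all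
  then have reals: "4 * real (alpha n) = real n * (real n + 1) * 2 ^ n"
      "2 * real (alpha_L n) = real n * 2 ^ n"
    by (simp_all add: algebra_simps)
  have powi: "(2::real) powi (int n - 2) = 2 ^ n / 4"
    by (simp add: power_int_diff)
  have "alpha_R n = n * 2 ^ (n - 1)" using R 2 by simp
  moreover have "real (alpha n) = real n * (real n + 1) * 2 powi (int n - 2)"
    using reals(1) by (simp add: powi)
  moreover have "real (alpha n) = (real n + 1) / 2 * real (alpha_L n)"
  proof -
    have "4 * real (alpha n) = (real n + 1) * (2 * real (alpha_L n))"
      unfolding reals by simp
    then show ?thesis by (simp add: mult.commute)
  qed
  ultimately show ?thesis using LR by blast
qed

end
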